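(* Let $p$ be a prime and $P$ a $p$-group of order at most $p^5$. Then $\mathcal{CD}(P)$ is a chain of length 1 if and only if $p \neq 2$, $|P| = p^5$, $|\mathrm{Z}(P)| = p^2$, $P/\mathrm{Z}(P)$ is extraspecial of exponent $p$, and $[Z_2(P),P] = \mathrm{Z}(P)$.
   Context: For a finite group $G$ and a subgroup $U \le G$, the Chermak-Delgado measure of $U$ in $G$ is $m_G(U) = |U|\,|C_G(U)|$. Put $m(G) = \max\{m_G(U) \mid U \le G\}$ and $\mathcal{CD}(G) = \{U \le G \mid m_G(U) = m(G)\}$, the Chermak-Delgado lattice of $G$. A chain of length $n$ is a series of subgroups $G_0 < G_1 < \dots < G_n$ with proper inclusions (so it has exactly $n+1$ members). $\mathrm{Z}(P)$ denotes the center of $P$, and $Z_2(P)$ denotes the second center, i.e. $Z_2(P)/\mathrm{Z}(P)$ is the center of $P/\mathrm{Z}(P)$. *)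

theory Defs
  imports "HOL-Algebra.Algebra" "HOL-Computational_Algebra.Primes"
begin

definition centralizer :: "('a, 'b) monoid_scheme \<Rightarrow> 'a set \<Rightarrow> 'a set" where
  "centralizer G U = {g \<in> carrier G. \<forall>u\<in>U. g \<otimes>\<^bsub>G\<^esub> u = u \<otimes>\<^bsub>G\<^esub> g}"

definition center :: "('a, 'b) monoid_scheme \<Rightarrow> 'a set" where
  "center G = centralizer G (carrier G)"

definition second_center :: "('a, 'b) monoid_scheme \<Rightarrow> 'a set" where
  "second_center G = {x \<in> carrier G. center G #>\<^bsub>G\<^esub> x \<in> center (G Mod center G)}"

definition commutator_subgroup ::
    "('a, 'b) monoid_scheme \<Rightarrow> 'a set \<Rightarrow> 'a set \<Rightarrow> 'a set" where
  "commutator_subgroup G H K =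
     generate G (\<Union>h\<in>H. \<Union>k\<in>K. {h \<otimes>\<^bsub>G\<^esub> k \<otimes>\<^bsub>G\<^esub> inv\<^bsub>G\<^esub> h \<otimes>\<^bsub>G\<^esub> inv\<^bsub>G\<^esub> k})"

text \<open>The Chermak-Delgado measure, its maximum and the Chermak-Delgado lattice; these are
  meaningful for finite groups only (the cardinality of an infinite set is 0, and Max is
  unspecified on infinite sets).\<close>

definition CD_measure :: "('a, 'b) monoid_scheme \<Rightarrow> 'a set \<Rightarrow> nat" where
  "CD_measure G U = card U * card (centralizer G U)"

definition CD_max :: "('a, 'b) monoid_scheme \<Rightarrow> nat" where
  "CD_max G = Max (CD_measure G ` {U. subgroup U G})"

definition CD_lattice :: "('a, 'b) monoid_scheme \<Rightarrow> 'a set set" where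
  "CD_lattice G = {U. subgroup U G \<and> CD_measure G U = CD_max G}"

text \<open>A chain of length \<open>n\<close> has \<open>n + 1\<close> members.\<close>

definition subgroup_chain ::
    "('a, 'b) monoid_scheme \<Rightarrow> nat \<Rightarrow> 'a set set \<Rightarrow> bool" where
  "subgroup_chain G n \<C> \<longleftrightarrow>
     (\<exists>S. (\<forall>i\<le>n. subgroup (S i) G) \<and> (\<forall>i<n. S i \<subset> S (Suc i)) \<and> \<C> = S ` {..n})"

text \<open>For prime \<open>p\<close>, the order being a power of \<open>p\<close> forces the group to be finite, since
  infinite groups have order 0.\<close>

definition p_group :: "nat \<Rightarrow> ('a, 'b) monoid_scheme \<Rightarrow> bool" where
  "p_group p G \<longleftrightarrow> group G \<and> Factorial_Ring.prime p \<and> (\<exists>n. order G = p ^ n)"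

definition maximal_subgroup :: "'a set \<Rightarrow> ('a, 'b) monoid_scheme \<Rightarrow> bool" where
  "maximal_subgroup M G \<longleftrightarrow> subgroup M G \<and> M \<noteq> carrier G \<and>
     (\<forall>H. subgroup H G \<longrightarrow> M \<subseteq> H \<longrightarrow> H = M \<or> H = carrier G)"

text \<open>The intersection with the carrier makes the Frattini subgroup the whole group when
  there are no maximal subgroups.\<close>

definition frattini :: "('a, 'b) monoid_scheme \<Rightarrow> 'a set" where
  "frattini G = carrier G \<inter> \<Inter>{M. maximal_subgroup M G}"

definition extraspecial :: "nat \<Rightarrow> ('a, 'b) monoid_scheme \<Rightarrow> bool" where
  "extraspecial p G \<longleftrightarrow> p_group p G \<and> center G = derived G (carrier G) \<and>
     center G = frattini G \<and> card (center G) = p"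

text \<open>Like \<open>CD_max\<close>, the exponent is only meaningful for finite groups, where the set of
  candidates is nonempty.\<close>

definition group_exponent :: "('a, 'b) monoid_scheme \<Rightarrow> nat" where
  "group_exponent G = (LEAST n. 0 < n \<and> (\<forall>x\<in>carrier G. x [^]\<^bsub>G\<^esub> n = \<one>\<^bsub>G\<^esub>))"

end

theory Submission
  imports Defs
begin

text \<open>
  Write \<open>C\<close> for centralizers and \<open>Z\<close> for \<open>Z(P)\<close>. If the Chermak-Delgado lattice is \<open>{A, B}\<close>
  with \<open>A < B\<close>, then \<open>C\<close> swaps \<open>A\<close> and \<open>B\<close>. A proper \<open>B\<close> would have \<open>|B : A| = p\<close> with
  \<open>A = Z(B)\<close>, which is absurd; hence \<open>B = P\<close>, \<open>A = Z\<close>. Comparing measures with the abelian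
  subgroups \<open>C(C(x))\<close> for noncentral \<open>x\<close>, and taking \<open>x\<close> in the second center, forces
  \<open>|P| = p\<^sup>5\<close>, \<open>|Z| = p\<^sup>2\<close> and \<open>|C(x)| = p\<^sup>3\<close> for all noncentral \<open>x\<close>. Conversely these three conditions
  imply that the lattice is \<open>{Z, P}\<close>. So both sides of the theorem only have to be compared with
  the bound \<open>|C(x)| \<le> p\<^sup>3\<close>. It makes \<open>C(x)/Z\<close> of order \<open>p\<close>, which gives the exponent, and
  \<open>[x, P] = Z\<close> for \<open>x\<close> in \<open>Z\<^sub>2(P) - Z\<close>; it excludes \<open>P/Z\<close> abelian, because an alternating form
  on a three-dimensional space with values in \<open>Z/K\<close>, \<open>|K| = p\<close>, is degenerate. In the other
  direction, a noncentral \<open>x\<close> with \<open>|C(x)| \<ge> p\<^sup>4\<close> yields one in \<open>Z\<^sub>2(P)\<close>, and then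
  \<open>[Z\<^sub>2(P), P] = [x, P]\<close> is too small.
\<close>

section \<open>Commutators and centralizers\<close>

definition comm :: "('a, 'b) monoid_scheme \<Rightarrow> 'a \<Rightarrow> 'a \<Rightarrow> 'a" where
  "comm G x y = x \<otimes>\<^bsub>G\<^esub> y \<otimes>\<^bsub>G\<^esub> inv\<^bsub>G\<^esub> x \<otimes>\<^bsub>G\<^esub> inv\<^bsub>G\<^esub> y"

text \<open>For a central subgroup \<open>K\<close> this is the preimage in \<open>G\<close> of the
  centralizer of the image of \<open>U\<close> in \<open>G/K\<close>; computations modulo
  \<open>K\<close> can thus take place in \<open>G\<close> itself.\<close>

definition centralizer_mod ::
    "('a, 'b) monoid_scheme \<Rightarrow> 'a set \<Rightarrow> 'a set \<Rightarrow> 'a set" where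
  "centralizer_mod G K U = {g \<in> carrier G. \<forall>u\<in>U. comm G u g \<in> K}"

context group
begin

lemma comm_closed [simp]: "x \<in> carrier G \<Longrightarrow> y \<in> carrier G \<Longrightarrow> comm G x y \<in> carrier G"
  by (simp add: comm_def)

lemma comm_mult_swap:
  assumes "x \<in> carrier G" "y \<in> carrier G"
  shows "comm G x y \<otimes> (y \<otimes> x) = x \<otimes> y"
  using assms by (simp add: comm_def m_assoc inv_solve_left')

lemma comm_eq_one_iff:
  assumes "x \<in> carrier G" "y \<in> carrier G"
  shows "comm G x y = \<one> \<longleftrightarrow> x \<otimes> y = y \<otimes> x"
  using comm_mult_swap[OF assms] assms
  by (metis comm_closed m_closed l_one r_cancel_one')

lemma comm_self [simp]: "x \<in> carrier G \<Longrightarrow> comm G x x = \<one>"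
  by (simp add: comm_eq_one_iff)

lemma inv_comm:
  assumes "x \<in> carrier G" "y \<in> carrier G"
  shows "inv (comm G x y) = comm G y x"
  using assms by (simp add: comm_def inv_mult_group m_assoc)

lemma comm_mult_right:
  assumes "x \<in> carrier G" "y \<in> carrier G" "z \<in> carrier G"
  shows "comm G x (y \<otimes> z) = comm G x y \<otimes> (y \<otimes> comm G x z \<otimes> inv y)"
proof -
  have *: "inv a \<otimes> (a \<otimes> b) = b" "a \<otimes> (inv a \<otimes> b) = b" if "a \<in> carrier G" "b \<in> carrier G" for a b
    using that by (simp_all add: m_assoc[symmetric])
  show ?thesis
    using assms by (simp add: comm_def m_assoc inv_mult_group *)
qed

lemma comm_mem_subgroup:
  "\<lbrakk>subgroup H G; x \<in> H; y \<in> H\<rbrakk> \<Longrightarrow> comm G x y \<in> H"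
  by (simp add: comm_def subgroup.m_closed subgroup.m_inv_closed)

section \<open>Centralizers and the center\<close>

lemma centralizer_subset: "centralizer G U \<subseteq> carrier G"
  by (auto simp: centralizer_def)

lemma centralizer_subgroup:
  assumes "U \<subseteq> carrier G"
  shows "subgroup (centralizer G U) G"
proof (rule subgroupI)
  show "inv a \<in> centralizer G U" if "a \<in> centralizer G U" for a
    using that assms unfolding centralizer_def
    by (smt (verit, best) inv_closed inv_solve_left' inv_solve_right' m_assoc m_closed mem_Collect_eq subsetD)
  show "a \<otimes> b \<in> centralizer G U" if "a \<in> centralizer G U" "b \<in> centralizer G U" for a b
    using that assms unfolding centralizer_def
    by (smt (verit, best) m_assoc m_closed mem_Collect_eq subsetD)
  have "\<one> \<in> centralizer G U"
    using assms by (auto simp: centralizer_def)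
  then show "centralizer G U \<noteq> {}" by blast
qed (auto simp: centralizer_def)

lemma centralizer_antimono: "U \<subseteq> V \<Longrightarrow> centralizer G V \<subseteq> centralizer G U"
  by (auto simp: centralizer_def)

lemma subset_centralizer_centralizer:
  "U \<subseteq> carrier G \<Longrightarrow> U \<subseteq> centralizer G (centralizer G U)"
  by (auto simp: centralizer_def)

lemma center_subset_centralizer: "U \<subseteq> carrier G \<Longrightarrow> center G \<subseteq> centralizer G U"
  by (auto simp: center_def centralizer_def)

lemma center_subset: "center G \<subseteq> carrier G"
  by (auto simp: center_def centralizer_def)

lemma centralizer_center: "centralizer G (center G) = carrier G"
  by (auto simp: center_def centralizer_def)

lemma centralizer_singleton_eq_carrier_iff:
  "x \<in> carrier G \<Longrightarrow> centralizer G {x} = carrier G \<longleftrightarrow> x \<in> center G"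
  unfolding center_def centralizer_def by (simp add: set_eq_iff) metis

lemma mem_centralizer_self: "x \<in> carrier G \<Longrightarrow> x \<in> centralizer G {x}"
  by (auto simp: centralizer_def)

lemma center_subgroup: "subgroup (center G) G"
  by (simp add: center_def centralizer_subgroup)

lemma center_normal: "center G \<lhd> G"
proof (rule normal_invI[OF center_subgroup])
  fix x h assume "x \<in> carrier G" "h \<in> center G"
  moreover from this have "x \<otimes> h = h \<otimes> x" "h \<in> carrier G"
    by (auto simp: center_def centralizer_def)
  ultimately show "x \<otimes> h \<otimes> inv x \<in> center G"
    by (simp add: m_assoc)
qed

lemma center_commute: "z \<in> center G \<Longrightarrow> x \<in> carrier G \<Longrightarrow> x \<otimes> z = z \<otimes> x"
  by (simp add: center_def centralizer_def)

lemma center_iff_comm: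
  "x \<in> center G \<longleftrightarrow> x \<in> carrier G \<and> (\<forall>y\<in>carrier G. comm G x y = \<one>)"
  by (auto simp: center_def centralizer_def comm_eq_one_iff)

lemma mem_centralizer_singleton_iff:
  "x \<in> carrier G \<Longrightarrow> g \<in> centralizer G {x} \<longleftrightarrow> g \<in> carrier G \<and> comm G x g = \<one>"
  by (auto simp: centralizer_def comm_eq_one_iff)

section \<open>Commutators with central values\<close>

lemma comm_mult_right_central:
  assumes "x \<in> carrier G" "y \<in> carrier G" "z \<in> carrier G" "comm G x z \<in> center G"
  shows "comm G x (y \<otimes> z) = comm G x y \<otimes> comm G x z"
proof -
  have "y \<otimes> comm G x z \<otimes> inv y = comm G x z"
    using assms center_commute[of "comm G x z" y] by (simp add: m_assoc)
  with assms comm_mult_right show ?thesis by simp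
qed

lemma comm_inv_right_central:
  assumes "x \<in> carrier G" "y \<in> carrier G" "comm G x y \<in> center G"
  shows "comm G x (inv y) = inv (comm G x y)"
proof -
  have "\<one> = comm G x (inv y \<otimes> y)"
    using assms by (simp add: comm_def)
  also have "\<dots> = comm G x (inv y) \<otimes> comm G x y"
    by (rule comm_mult_right_central) (use assms in auto)
  finally show ?thesis
    using assms by (metis comm_closed inv_closed inv_equality)
qed

text \<open>As \<open>K\<close> is central, \<open>comm G u\<close> is multiplicative on elements
  that it sends into \<open>K\<close>, so the closure properties of \<open>K\<close> carry
  over.\<close>

lemma centralizer_mod_subgroup:
  assumes K: "subgroup K G" "K \<subseteq> center G" and U: "U \<subseteq> carrier G"
  shows "subgroup (centralizer_mod G K U) G"
proof (rule subgroupI)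
  show "centralizer_mod G K U \<subseteq> carrier G"
    by (auto simp: centralizer_mod_def)
  have "\<one> \<in> centralizer_mod G K U"
    using U subgroup.one_closed[OF K(1)] by (auto simp: centralizer_mod_def comm_def subset_iff)
  then show "centralizer_mod G K U \<noteq> {}" by blast
  show "inv a \<in> centralizer_mod G K U" if "a \<in> centralizer_mod G K U" for a
    using that K U comm_inv_right_central subgroup.m_inv_closed[OF K(1)]
    by (auto simp: centralizer_mod_def subset_iff)
  show "a \<otimes> b \<in> centralizer_mod G K U"
    if "a \<in> centralizer_mod G K U" "b \<in> centralizer_mod G K U" for a b
    using that K U comm_mult_right_central subgroup.m_closed[OF K(1)]
    by (auto simp: centralizer_mod_def subset_iff)
qed

lemma comm_center:
  assumes "x \<in> carrier G" "z \<in> center G"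
  shows "comm G x z = \<one>" "comm G z x = \<one>"
proof -
  show "comm G z x = \<one>" using assms by (simp add: center_iff_comm)
  then show "comm G x z = \<one>"
    using assms center_subset by (metis inv_comm inv_one subsetD)
qed

lemma center_subset_centralizer_mod:
  "subgroup K G \<Longrightarrow> U \<subseteq> carrier G \<Longrightarrow> center G \<subseteq> centralizer_mod G K U"
  using center_subset by (auto simp: centralizer_mod_def comm_center subgroup.one_closed subset_iff)

text \<open>Since \<open>[y, x]\<close> is the inverse of \<open>[x, y]\<close>, commuting modulo
  \<open>K\<close> is a symmetric relation.\<close>

lemma centralizer_mod_sym:
  assumes "subgroup K G" "x \<in> carrier G" "y \<in> centralizer_mod G K {x}"
  shows "x \<in> centralizer_mod G K {y}"
  using assms subgroup.m_inv_closed[OF assms(1)] inv_comm[of x y]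
  by (auto simp: centralizer_mod_def) (metis assms(1) subgroup.m_inv_closed)

lemma centralizer_subset_centralizer_mod:
  "subgroup K G \<Longrightarrow> x \<in> carrier G \<Longrightarrow> centralizer G {x} \<subseteq> centralizer_mod G K {x}"
  by (auto simp: centralizer_mod_def mem_centralizer_singleton_iff subgroup.one_closed)

text \<open>The hypothesis says that \<open>x\<close> lies in the second center. Every
  \<open>[x, y]\<close> is then central, so \<open>comm G x\<close> is a homomorphism from
  \<open>G\<close> to the center.\<close>

lemma comm_image_subgroup:
  assumes "x \<in> centralizer_mod G (center G) (carrier G)"
  shows "subgroup (comm G x ` carrier G) G" "comm G x ` carrier G \<subseteq> center G"
proof -
  have x: "x \<in> carrier G" using assms by (simp add: centralizer_mod_def)
  have *: "comm G x y \<in> center G" if "y \<in> carrier G" for y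
  proof -
    have "y \<in> centralizer_mod G (center G) {x}"
      by (rule centralizer_mod_sym[OF center_subgroup that])
        (use assms that in \<open>auto simp: centralizer_mod_def\<close>)
    then show ?thesis by (simp add: centralizer_mod_def)
  qed
  then show "comm G x ` carrier G \<subseteq> center G" by auto
  show "subgroup (comm G x ` carrier G) G"
  proof (rule subgroupI)
    fix a b assume "a \<in> comm G x ` carrier G" "b \<in> comm G x ` carrier G"
    then obtain y z where yz: "y \<in> carrier G" "a = comm G x y" "z \<in> carrier G" "b = comm G x z"
      by blast
    have "inv a = comm G x (inv y)" "a \<otimes> b = comm G x (y \<otimes> z)"
      using yz x * comm_inv_right_central comm_mult_right_central by auto
    then show "inv a \<in> comm G x ` carrier G" "a \<otimes> b \<in> comm G x ` carrier G"
      using yz by auto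
  qed (use x in auto)
qed

text \<open>Writing \<open>[x, h] = x (h x h^-1)^-1\<close> shows that equal commutators mean equal
  conjugates of \<open>x\<close>, that is, \<open>h\<close> and \<open>k\<close> in the same left
  coset of \<open>C(x)\<close>.\<close>

lemma comm_eq_comm_iff:
  assumes "x \<in> carrier G" "h \<in> carrier G" "k \<in> carrier G"
  shows "comm G x h = comm G x k \<longleftrightarrow> inv k \<otimes> h \<in> centralizer G {x}"
proof -
  have *: "comm G x h = x \<otimes> inv (h \<otimes> x \<otimes> inv h)" if "h \<in> carrier G" for h
    using that assms by (simp add: comm_def inv_mult_group m_assoc)
  have "comm G x h = comm G x k \<longleftrightarrow> h \<otimes> x \<otimes> inv h = k \<otimes> x \<otimes> inv k"
    using assms by (simp add: *) (metis inv_closed inv_inv m_closed)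
  also have "\<dots> \<longleftrightarrow> h \<otimes> x = k \<otimes> x \<otimes> inv k \<otimes> h"
    using assms by (metis inv_closed inv_solve_right' m_closed)
  also have "\<dots> \<longleftrightarrow> inv k \<otimes> (h \<otimes> x) = x \<otimes> (inv k \<otimes> h)"
    using assms by (simp add: m_assoc inv_solve_left')
  also have "\<dots> \<longleftrightarrow> inv k \<otimes> h \<in> centralizer G {x}"
    using assms by (simp add: centralizer_def m_assoc)
  finally show ?thesis .
qed

text \<open>Orbit-stabilizer for conjugation: \<open>[x, h]\<close> determines the conjugate \<open>h x h\<^sup>-\<^sup>1\<close> and
  vice versa.\<close>

lemma card_subgroup_eq_centralizer_comm:
  assumes fin: "finite (carrier G)" and H: "subgroup H G" and x: "x \<in> carrier G"
  shows "card H = card (centralizer G {x} \<inter> H) * card (comm G x ` H)"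
proof -
  have HG: "H \<subseteq> carrier G" by (rule subgroup.subset[OF H])
  have finH: "finite H" using HG fin finite_subset by blast
  have "card {h \<in> H. comm G x h = c} = card (centralizer G {x} \<inter> H)" if c: "c \<in> comm G x ` H" for c
  proof -
    obtain k where k: "k \<in> H" "c = comm G x k" using c by blast
    have "bij_betw (\<lambda>h. k \<otimes> h) (centralizer G {x} \<inter> H) {h \<in> H. comm G x h = c}"
    proof (rule bij_betwI[where g = "\<lambda>h. inv k \<otimes> h"])
      show "(\<lambda>h. k \<otimes> h) \<in> centralizer G {x} \<inter> H \<rightarrow> {h \<in> H. comm G x h = c}"
      proof
        fix h assume "h \<in> centralizer G {x} \<inter> H"
        then show "k \<otimes> h \<in> {h \<in> H. comm G x h = c}"
          using k HG x subgroup.m_closed[OF H]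
          by (auto simp: comm_eq_comm_iff subset_iff m_assoc[symmetric])
      qed
      show "(\<lambda>h. inv k \<otimes> h) \<in> {h \<in> H. comm G x h = c} \<rightarrow> centralizer G {x} \<inter> H"
        using k HG x subgroup.m_closed[OF H] subgroup.m_inv_closed[OF H]
        by (auto simp: comm_eq_comm_iff[symmetric] subset_iff)
      show "inv k \<otimes> (k \<otimes> h) = h" if "h \<in> centralizer G {x} \<inter> H" for h
        using k HG that by (auto simp: m_assoc[symmetric] subset_iff)
      show "k \<otimes> (inv k \<otimes> h) = h" if "h \<in> {h \<in> H. comm G x h = c}" for h
        using k HG that by (auto simp: m_assoc[symmetric] subset_iff)
    qed
    then show ?thesis using bij_betw_same_card by metis
  qed
  then have "(\<Sum>c\<in>comm G x ` H. card {h \<in> H. comm G x h = c})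
      = card (comm G x ` H) * card (centralizer G {x} \<inter> H)"
    by simp
  moreover have "card H = (\<Sum>c\<in>comm G x ` H. card {h \<in> H. comm G x h = c})"
    using sum.image_gen[OF finH, of "\<lambda>_. 1::nat" "comm G x"] by simp
  ultimately show ?thesis by simp
qed

text \<open>This is the class equation: the noncentral elements split into conjugacy classes of size
  \<open>|G : C(x)|\<close>, each divisible by \<open>p\<close>.\<close>

lemma dvd_card_center:
  assumes fin: "finite (carrier G)" and p: "p dvd order G"
    and cl: "\<And>x. x \<in> carrier G - center G \<Longrightarrow> p * card (centralizer G {x}) dvd order G"
  shows "p dvd card (center G)"
proof -
  let ?\<phi> = "\<lambda>g. \<lambda>h \<in> carrier G. g \<otimes> h \<otimes> inv g"
  interpret A: group_action G "carrier G" ?\<phi> by (rule action_by_conjugation)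
  have stab: "stabilizer G ?\<phi> x = centralizer G {x}" if "x \<in> carrier G" for x
    using that by (auto simp: stabilizer_def centralizer_def inv_solve_right')
  let ?C = "(\<lambda>x. orbit G ?\<phi> x) ` (carrier G - center G)"
  have orb: "orbit G ?\<phi> x \<subseteq> carrier G" if "x \<in> carrier G" for x
    using that by (auto simp: orbit_def)
  \<comment> \<open>A central element is conjugate only to itself, so the class of a noncentral
    element avoids the center.\<close>
  have noncentral: "y \<in> carrier G - center G"
    if "y \<in> orbit G ?\<phi> x" "x \<in> carrier G - center G" for x y
  proof -
    have y: "y \<in> carrier G" using that orb by auto
    have "x \<in> orbit G ?\<phi> y" using A.orbit_sym[of x y] that y by auto
    then obtain g where g: "g \<in> carrier G" "x = g \<otimes> y \<otimes> inv g"
      using y by (auto simp: orbit_def)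
    have "x = y" if "y \<in> center G"
      using that g y center_commute[of y g] by (simp add: m_assoc)
    then have "y \<notin> center G" using that(2) by auto
    with y show ?thesis by simp
  qed
  have U: "\<Union>?C = carrier G - center G"
  proof
    show "\<Union>?C \<subseteq> carrier G - center G" using noncentral by blast
    show "carrier G - center G \<subseteq> \<Union>?C" using A.orbit_refl by blast
  qed
  have "p dvd card (\<Union>?C)"
  proof (rule dvd_partition)
    show "finite (\<Union>?C)" using U fin by simp
    show "\<forall>c\<in>?C. p dvd card c"
    proof
      fix c assume "c \<in> ?C"
      then obtain x where x: "x \<in> carrier G - center G" "c = orbit G ?\<phi> x" by auto
      have "card c * card (centralizer G {x}) = order G"
        using A.orbit_stabilizer_theorem[of x] x stab[of x] by (simp add: mult.commute)
      moreover have "card (centralizer G {x}) > 0"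
        using mem_centralizer_self x fin centralizer_subset by (metis DiffD1 card_gt_0_iff empty_iff finite_subset)
      ultimately show "p dvd card c"
        using cl[OF x(1)] by (metis mult.commute nat_less_le nat_mult_dvd_cancel1)
    qed
    show "\<forall>c1\<in>?C. \<forall>c2\<in>?C. c1 \<noteq> c2 \<longrightarrow> c1 \<inter> c2 = {}"
    proof (clarify)
      fix x y assume xy: "x \<in> carrier G" "y \<in> carrier G" "orbit G ?\<phi> x \<noteq> orbit G ?\<phi> y"
      have "orbit G ?\<phi> x \<in> orbits G (carrier G) ?\<phi>" "orbit G ?\<phi> y \<in> orbits G (carrier G) ?\<phi>"
        unfolding orbits_def using xy by blast+
      then show "orbit G ?\<phi> x \<inter> orbit G ?\<phi> y = {}"
        using xy(3) A.disjoint_union by blast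
    qed
  qed
  then have "p dvd order G - card (center G)"
    using U fin center_subset by (simp add: order_def card_Diff_subset finite_subset)
  moreover have "card (center G) \<le> order G"
    using fin center_subset by (simp add: order_def card_mono)
  ultimately show ?thesis
    using p by (metis dvd_diff_nat diff_diff_cancel)
qed

section \<open>Cosets of the center and the second center\<close>

lemma card_subgroup_eq_card_cosets:
  assumes H: "subgroup H G" and N: "subgroup N G" "N \<subseteq> H"
  shows "card H = card ((\<lambda>x. N #> x) ` H) * card N"
proof -
  interpret H: group "G\<lparr>carrier := H\<rparr>" by (rule subgroup_imp_group[OF H])
  have "subgroup N (G\<lparr>carrier := H\<rparr>)" by (rule subgroup_incl[OF N(1) H N(2)])
  from H.lagrange[OF this] show ?thesis
    by (simp add: order_def RCOSETS_def r_coset_def UNION_singleton_eq_range)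
qed

lemma center_coset_eq_iff:
  assumes "a \<in> carrier G" "b \<in> carrier G"
  shows "center G #> a = center G #> b \<longleftrightarrow> a \<otimes> inv b \<in> center G"
proof -
  have Z: "subgroup (center G) G" by (rule center_subgroup)
  have "center G #> a = center G #> b \<longleftrightarrow> a \<in> center G #> b"
    using assms by (metis Z rcos_self repr_independence)
  also have "\<dots> \<longleftrightarrow> a \<otimes> inv b \<in> center G"
    using assms subgroup.rcos_module[OF Z is_group] by simp
  finally show ?thesis .
qed

lemma center_cosets_commute_iff:
  assumes "x \<in> carrier G" "y \<in> carrier G"
  shows "(center G #> x) <#> (center G #> y) = (center G #> y) <#> (center G #> x)
    \<longleftrightarrow> comm G x y \<in> center G"
proof -
  have "x \<otimes> y \<otimes> inv (y \<otimes> x) = comm G x y"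
    using assms by (simp add: comm_def inv_mult_group m_assoc)
  then show ?thesis
    using assms by (simp add: normal.rcos_sum[OF center_normal] center_coset_eq_iff)
qed

text \<open>Cosets of the center commute exactly when the commutator of their representatives is
  central. The second center can then be treated without passing to the quotient.\<close>

lemma second_center_eq: "second_center G = centralizer_mod G (center G) (carrier G)"
proof -
  have "center G #> x \<in> center (G Mod center G) \<longleftrightarrow> (\<forall>g\<in>carrier G. comm G g x \<in> center G)"
    if "x \<in> carrier G" for x
  proof -
    have "center G #> x \<in> center (G Mod center G) \<longleftrightarrow>
       (\<forall>g\<in>carrier G. (center G #> g) <#> (center G #> x) = (center G #> x) <#> (center G #> g))"
      using that by (auto simp: center_def[of "G Mod _"] centralizer_def[of "G Mod _"] carrier_FactGroup)
    then show ?thesis using that by (simp add: center_cosets_commute_iff)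
  qed
  then show ?thesis by (auto simp: second_center_def centralizer_mod_def)
qed

lemma center_subset_second_center: "center G \<subseteq> second_center G"
  by (simp add: second_center_eq center_subset_centralizer_mod center_subgroup)

lemma second_center_subgroup: "subgroup (second_center G) G"
  by (simp add: second_center_eq centralizer_mod_subgroup center_subgroup)

lemma center_cosets_second_center:
  "(\<lambda>x. center G #> x) ` second_center G = center (G Mod center G)"
  by (auto simp: second_center_def center_def[of "G Mod _"] centralizer_def[of "G Mod _"]
      carrier_FactGroup)

end

section \<open>Groups of prime power order\<close>

locale prime_power_group = group G for G (structure) +
  fixes p n :: nat
  assumes prime_p: "Factorial_Ring.prime p" and order_eq: "order G = p ^ n"
begin

text \<open>On subgroups this is the base \<open>p\<close> logarithm of the order; it turns indices
  and measures into linear arithmetic.\<close>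

definition lg :: "'a set \<Rightarrow> nat" where
  "lg H = multiplicity p (card H)"

lemma p_gt_1: "1 < p"
  using prime_p by (rule prime_gt_1_nat)

lemma finite_carrier [simp]: "finite (carrier G)"
  using order_eq p_gt_1 by (simp add: order_gt_0_iff_finite[symmetric])

lemma finite_subgroup: "subgroup H G \<Longrightarrow> finite H"
  by (meson finite_carrier finite_subset subgroup.subset)

lemma lg_eqI: "card H = p ^ k \<Longrightarrow> lg H = k"
  using p_gt_1 prime_p by (simp add: lg_def)

lemma card_eq_lg:
  assumes "subgroup H G"
  shows "card H = p ^ lg H"
proof -
  have "card H dvd p ^ n"
    using lagrange[OF assms] order_eq by (metis dvd_triv_right)
  then obtain k where "card H = p ^ k"
    using divides_primepow_nat[OF prime_p] by blast
  then show ?thesis using lg_eqI by simp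
qed

lemma lg_carrier [simp]: "lg (carrier G) = n"
  by (rule lg_eqI) (use order_eq in \<open>simp add: order_def\<close>)

lemma lg_mono:
  assumes "subgroup H G" "subgroup K G" "H \<subseteq> K"
  shows "lg H \<le> lg K"
proof -
  have "p ^ lg H \<le> p ^ lg K"
    using assms finite_subgroup by (simp add: card_eq_lg[symmetric] card_mono)
  then show ?thesis using p_gt_1 by simp
qed

lemma lg_eqD:
  assumes "subgroup H G" "subgroup K G" "H \<subseteq> K" "lg K \<le> lg H"
  shows "H = K"
proof -
  have "card H = card K"
    using assms lg_mono by (metis card_eq_lg le_antisym)
  then show ?thesis
    using assms finite_subgroup by (simp add: card_subset_eq)
qed

lemma lg_less:
  assumes "subgroup H G" "subgroup K G" "H \<subseteq> K" "H \<noteq> K"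
  shows "lg H < lg K"
  using assms lg_eqD not_le by blast

lemma lg_less_mem:
  assumes "subgroup H G" "subgroup K G" "H \<subseteq> K" "x \<in> K" "x \<notin> H"
  shows "lg H < lg K"
  using assms lg_less by blast

lemma lg_le: "subgroup H G \<Longrightarrow> lg H \<le> n"
  using lg_mono[of H "carrier G"] subgroup_self subgroup.subset by fastforce

lemma lg_proper: "subgroup H G \<Longrightarrow> H \<noteq> carrier G \<Longrightarrow> lg H < n"
  using lg_less[of H "carrier G"] subgroup_self subgroup.subset by fastforce

lemma lg_eq_carrier: "subgroup H G \<Longrightarrow> n \<le> lg H \<Longrightarrow> H = carrier G"
  using lg_proper not_le by blast

lemma subgroup_centralizer_singleton: "x \<in> carrier G \<Longrightarrow> subgroup (centralizer G {x}) G"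
  by (simp add: centralizer_subgroup)

text \<open>Strictness at the lower end comes from \<open>x\<close> itself, which lies in
  \<open>C(x)\<close> but not in the center. In small groups these bounds pin down
  \<open>|C(x)|\<close>.\<close>

lemma lg_center_less_centralizer:
  assumes "x \<in> carrier G" "x \<notin> center G"
  shows "lg (center G) < lg (centralizer G {x})" "lg (centralizer G {x}) < n"
proof -
  show "lg (center G) < lg (centralizer G {x})"
    by (rule lg_less_mem[of _ _ x])
      (use assms in \<open>auto simp: center_subgroup centralizer_subgroup center_subset_centralizer
        mem_centralizer_self\<close>)
  show "lg (centralizer G {x}) < n"
    by (rule lg_proper) (use assms in \<open>auto simp: centralizer_subgroup centralizer_singleton_eq_carrier_iff\<close>)
qed

lemma lg_center_pos:
  assumes "0 < n"
  shows "0 < lg (center G)"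
proof -
  have "p dvd card (center G)"
  proof (rule dvd_card_center)
    show "p dvd order G" using assms by (simp add: order_eq)
    show "p * card (centralizer G {x}) dvd order G" if "x \<in> carrier G - center G" for x
    proof -
      have "Suc (lg (centralizer G {x})) \<le> n"
        using lg_center_less_centralizer[of x] that by auto
      then have "p ^ Suc (lg (centralizer G {x})) dvd p ^ n" by (rule le_imp_power_dvd)
      then show ?thesis
        using that by (simp add: order_eq card_eq_lg centralizer_subgroup)
    qed
  qed simp
  then have "card (center G) \<noteq> 1" using p_gt_1 by (metis less_irrefl nat_dvd_1_iff_1)
  then have "lg (center G) \<noteq> 0"
    using card_eq_lg[OF center_subgroup] by (intro notI) simp
  then show ?thesis by simp
qed

lemma card_comm_image:
  assumes "subgroup H G" "x \<in> carrier G"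
  shows "card (comm G x ` H) = p ^ (lg H - lg (centralizer G {x} \<inter> H))"
proof -
  let ?C = "centralizer G {x} \<inter> H"
  have C: "subgroup ?C G"
    using assms by (simp add: centralizer_subgroup subgroups_Inter_pair)
  have "p ^ lg ?C * card (comm G x ` H) = p ^ lg H"
    using card_subgroup_eq_centralizer_comm[OF finite_carrier assms]
    unfolding card_eq_lg[OF C] card_eq_lg[OF assms(1)] by (rule sym)
  also have "\<dots> = p ^ lg ?C * p ^ (lg H - lg ?C)"
    using lg_mono[OF C assms(1)] by (metis le_add_diff_inverse power_add inf_le2)
  finally have "p ^ lg ?C * card (comm G x ` H) = p ^ lg ?C * p ^ (lg H - lg ?C)" .
  then show ?thesis using p_gt_1 by (metis mult_left_cancel not_less0 power_not_zero)
qed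

lemma card_comm_image_carrier:
  assumes "x \<in> carrier G"
  shows "card (comm G x ` carrier G) = p ^ (n - lg (centralizer G {x}))"
  using card_comm_image[OF subgroup_self assms] centralizer_subset[of "{x}"]
  by (simp add: Int_absorb2)

lemma quotient_by_center: "prime_power_group (G Mod center G) p (n - lg (center G))"
proof -
  have "p ^ n = card (carrier (G Mod center G)) * p ^ lg (center G)"
    using card_subgroup_eq_card_cosets[OF subgroup_self center_subgroup center_subset]
      card_eq_lg[OF center_subgroup] order_eq by (simp add: order_def carrier_FactGroup)
  moreover have "p ^ n = p ^ (n - lg (center G)) * p ^ lg (center G)"
    using lg_le[OF center_subgroup] by (simp add: power_add[symmetric])
  ultimately have "order (G Mod center G) = p ^ (n - lg (center G))"
    using p_gt_1 by (simp add: order_def)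
  then show ?thesis
    using normal.factorgroup_is_group[OF center_normal] prime_p
    by (simp add: prime_power_group_def prime_power_group_axioms_def)
qed

text \<open>The second center is the full preimage of the center of the quotient by the
  center.\<close>

lemma lg_second_center:
  "lg (second_center G) = prime_power_group.lg p (center (G Mod center G)) + lg (center G)"
proof -
  interpret Q: prime_power_group "G Mod center G" p "n - lg (center G)"
    by (rule quotient_by_center)
  have "card (second_center G) = card (center (G Mod center G)) * card (center G)"
    using card_subgroup_eq_card_cosets[OF second_center_subgroup center_subgroup
        center_subset_second_center]
    by (simp add: center_cosets_second_center)
  then show ?thesis
    by (intro lg_eqI) (simp add: power_add card_eq_lg[OF center_subgroup] Q.card_eq_lg[OF Q.center_subgroup])
qed

text \<open>The quotient by the center is a nontrivial \<open>p\<close>-group, so its own center is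
  nontrivial.\<close>

lemma second_center_gt_center:
  assumes "center G \<noteq> carrier G"
  obtains x where "x \<in> second_center G" "x \<notin> center G"
proof -
  interpret Q: prime_power_group "G Mod center G" p "n - lg (center G)"
    by (rule quotient_by_center)
  have "lg (center G) < n" using assms lg_proper center_subgroup by blast
  then have "lg (center G) < lg (second_center G)"
    using Q.lg_center_pos by (simp add: lg_second_center)
  then have "\<not> second_center G \<subseteq> center G"
    using lg_mono center_subgroup second_center_subgroup leD by blast
  then show thesis using that by auto
qed

section \<open>The Chermak-Delgado lattice\<close>

lemma CD_measure_eq_power:
  assumes "subgroup U G"
  shows "CD_measure G U = p ^ (lg U + lg (centralizer G U))"
  using assms centralizer_subgroup[OF subgroup.subset[OF assms]]
  by (simp add: CD_measure_def card_eq_lg power_add)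

lemma CD_measure_le_CD_max:
  assumes "subgroup U G"
  shows "CD_measure G U \<le> CD_max G"
proof -
  have "{U. subgroup U G} \<subseteq> Pow (carrier G)" using subgroup.subset by auto
  then have "finite {U. subgroup U G}" by (rule finite_subset) simp
  then show ?thesis using assms by (simp add: CD_max_def)
qed

text \<open>All measures are powers of \<open>p\<close>, so maximality can be tested on exponents
  and \<open>Max\<close> disappears.\<close>

lemma CD_lattice_iff:
  "U \<in> CD_lattice G \<longleftrightarrow> subgroup U G \<and>
    (\<forall>V. subgroup V G \<longrightarrow> lg V + lg (centralizer G V) \<le> lg U + lg (centralizer G U))"
proof -
  have fin: "finite {U. subgroup U G}"
    by (rule finite_subset[of _ "Pow (carrier G)"]) (use subgroup.subset in auto)
  have "CD_measure G U = CD_max G \<longleftrightarrow> (\<forall>V. subgroup V G \<longrightarrow> CD_measure G V \<le> CD_measure G U)"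
    if "subgroup U G"
    using that fin CD_measure_le_CD_max unfolding CD_max_def
    by (subst eq_commute, subst Max_eq_iff) auto
  then show ?thesis
    using p_gt_1 by (auto simp: CD_lattice_def CD_measure_eq_power)
qed

text \<open>The measure of \<open>C(U)\<close> cannot exceed that of \<open>U\<close>, which gives
  \<open>|C(C(U))| \<le> |U|\<close>; the inclusion of \<open>U\<close> in \<open>C(C(U))\<close> is
  then an equality.\<close>

lemma centralizer_centralizer_CD:
  assumes "U \<in> CD_lattice G"
  shows "centralizer G (centralizer G U) = U" "centralizer G U \<in> CD_lattice G"
proof -
  have U: "subgroup U G" and UC: "U \<subseteq> carrier G"
    using assms subgroup.subset by (auto simp: CD_lattice_def)
  have C: "subgroup (centralizer G U) G"
    by (rule centralizer_subgroup[OF UC])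
  have CC: "subgroup (centralizer G (centralizer G U)) G"
    by (rule centralizer_subgroup[OF centralizer_subset])
  have "lg (centralizer G U) + lg (centralizer G (centralizer G U)) \<le> lg U + lg (centralizer G U)"
    using assms C by (simp add: CD_lattice_iff)
  then show *: "centralizer G (centralizer G U) = U"
    using lg_eqD[OF U CC subset_centralizer_centralizer[OF UC]] by simp
  show "centralizer G U \<in> CD_lattice G"
    using assms C by (simp add: CD_lattice_iff * add.commute)
qed

text \<open>The condition to which both sides of the theorem are shown equivalent. As
  \<open>C(x)\<close> properly contains the center, the upper bound amounts to
  \<open>|C(x)| = p^3\<close>.\<close>

definition small_centralizers :: bool where
  "small_centralizers \<longleftrightarrow> n = 5 \<and> lg (center G) = 2 \<and>
     (\<forall>x\<in>carrier G - center G. lg (centralizer G {x}) \<le> 3)"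

lemma small_centralizers_imp_CD_lattice:
  assumes small_centralizers
  shows "CD_lattice G = {center G, carrier G}"
proof -
  have n: "n = 5" and z: "lg (center G) = 2"
    and c: "\<And>x. x \<in> carrier G \<Longrightarrow> x \<notin> center G \<Longrightarrow> lg (centralizer G {x}) \<le> 3"
    using assms by (auto simp: small_centralizers_def)
  \<comment> \<open>The exponent 7 is \<open>5 + 2\<close>, attained by the center and by the whole
    group.\<close>
  have *: "lg U + lg (centralizer G U) < 7"
    if U: "subgroup U G" "U \<noteq> center G" "U \<noteq> carrier G" for U
  proof (rule ccontr)
    assume "\<not> lg U + lg (centralizer G U) < 7"
    then have ge: "7 \<le> lg U + lg (centralizer G U)" by simp
    have UC: "U \<subseteq> carrier G" by (rule subgroup.subset[OF U(1)])
    have C: "subgroup (centralizer G U) G" by (rule centralizer_subgroup[OF UC])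
    show False
    proof (cases "U \<subseteq> center G")
      case True
      then have "lg U < 2" using lg_less[OF U(1) center_subgroup] U(2) z by simp
      then show False using lg_le[OF C] ge n by simp
    next
      case False
      then obtain u where u: "u \<in> U" "u \<notin> center G" by auto
      have "lg (centralizer G U) \<le> lg (centralizer G {u})"
        using u UC by (intro lg_mono C centralizer_antimono) (auto simp: centralizer_subgroup)
      also have "\<dots> \<le> 3" using c[of u] u UC by auto
      \<comment> \<open>Now \<open>U\<close> is too large to centralize any noncentral element. So
        \<open>C(U)\<close> is central, and reaching 7 would require \<open>U\<close> to be the
        whole group.\<close>
      finally have U4: "4 \<le> lg U" using ge by simp
      have "centralizer G U \<subseteq> center G"
      proof
        fix v assume v: "v \<in> centralizer G U"
        show "v \<in> center G"
        proof (rule ccontr)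
          assume nv: "v \<notin> center G"
          have vC: "v \<in> carrier G" using v by (simp add: centralizer_def)
          have "lg U \<le> lg (centralizer G {v})"
            using vC v UC
            by (intro lg_mono U subgroup_centralizer_singleton) (auto simp: centralizer_def)
          then show False using c[OF vC nv] U4 by simp
        qed
      qed
      then have "lg (centralizer G U) \<le> 2" using lg_mono[OF C center_subgroup] z by simp
      then show False using ge n lg_proper[OF U(1,3)] by simp
    qed
  qed
  have 7: "lg (center G) + lg (centralizer G (center G)) = 7"
    "lg (carrier G) + lg (centralizer G (carrier G)) = 7"
    using n z by (simp_all add: centralizer_center center_def[symmetric])
  have le: "lg U + lg (centralizer G U) \<le> 7" if "subgroup U G" for U
    using *[OF that] 7 by (cases "U = center G \<or> U = carrier G") auto
  show ?thesis
  proof (intro equalityI subsetI)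
    fix U assume "U \<in> CD_lattice G"
    then have "subgroup U G" "7 \<le> lg U + lg (centralizer G U)"
      using subgroup_self 7 unfolding CD_lattice_iff by metis+
    then show "U \<in> {center G, carrier G}" using *[of U] by auto
  next
    fix U assume "U \<in> {center G, carrier G}"
    then have "subgroup U G" "lg U + lg (centralizer G U) = 7"
      using center_subgroup subgroup_self 7 by blast+
    then show "U \<in> CD_lattice G" using le unfolding CD_lattice_iff by metis
  qed
qed

lemma chain_imp_small_centralizers:
  assumes n: "n \<le> 5" and CD: "CD_lattice G = {A, B}" and AB: "A \<subset> B"
  shows small_centralizers
proof -
  have A: "subgroup A G" and B: "subgroup B G" using CD by (auto simp: CD_lattice_def)
  have AC: "A \<subseteq> carrier G" and BC: "B \<subseteq> carrier G" using A B subgroup.subset by auto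
  have CA: "centralizer G A \<in> {A, B}" "centralizer G (centralizer G A) = A"
    and CB: "centralizer G B \<in> {A, B}" "centralizer G (centralizer G B) = B"
    using centralizer_centralizer_CD CD by auto
  \<comment> \<open>Taking centralizers reverses inclusions and is an involution on the lattice, so
    it must swap \<open>A\<close> and \<open>B\<close>.\<close>
  have CBA: "centralizer G B \<subseteq> centralizer G A" using AB by (intro centralizer_antimono) auto
  have cA: "centralizer G A = B" and cB: "centralizer G B = A"
    using CA CB CBA AB by auto
  have max: "lg U + lg (centralizer G U) < lg A + lg B"
    if U: "subgroup U G" "U \<noteq> A" "U \<noteq> B" for U
  proof -
    have "U \<notin> CD_lattice G" using U CD by simp
    then obtain V where V: "subgroup V G"
      "lg U + lg (centralizer G U) < lg V + lg (centralizer G V)"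
      using U(1) by (auto simp: CD_lattice_iff not_le)
    moreover have "A \<in> CD_lattice G" using CD by simp
    ultimately show ?thesis by (fastforce simp: CD_lattice_iff cA)
  qed
  have ZA: "center G \<subseteq> A" using center_subset_centralizer[OF BC] cB by simp
  have lgAB: "lg A < lg B" using lg_less[OF A B] AB by auto
  have npos: "0 < n" using lg_le[OF B] lgAB by simp
  have zpos: "0 < lg (center G)" by (rule lg_center_pos[OF npos])
  have BG: "B = carrier G"
  proof (rule ccontr)
    assume nB: "B \<noteq> carrier G"
    have "carrier G \<noteq> A" using AB BC by auto
    then have "n + lg (center G) < lg A + lg B"
      using max[OF subgroup_self] nB by (auto simp: center_def)
    moreover have "lg B < n" by (rule lg_proper[OF B nB])
    \<comment> \<open>The bounds leave only \<open>n = 5\<close>, \<open>lg A = 3\<close>,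
      \<open>lg B = 4\<close>.\<close>
    ultimately have AB': "Suc (lg A) = lg B" using zpos n lgAB by linarith
    obtain b where b: "b \<in> B" "b \<notin> A" using AB by auto
    have bC: "b \<in> carrier G" using b BC by auto
    have sub: "subgroup (centralizer G {b} \<inter> B) G"
      using bC B by (simp add: centralizer_subgroup subgroups_Inter_pair)
    \<comment> \<open>\<open>A = C(B)\<close> centralizes \<open>b\<close>. With \<open>b\<close>
      outside \<open>A\<close> and index \<open>p\<close>, this makes \<open>b\<close> central in
      \<open>B\<close>, which puts it into \<open>A\<close>.\<close>
    have "A \<subseteq> centralizer G {b} \<inter> B"
      using AB b AC by (auto simp: cB[symmetric] centralizer_def)
    then have "lg A < lg (centralizer G {b} \<inter> B)"
      using b bC by (intro lg_less_mem[OF A sub, of b]) (auto simp: mem_centralizer_self)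
    then have "centralizer G {b} \<inter> B = B"
      using AB' by (intro lg_eqD[OF sub B]) auto
    then have "b \<in> centralizer G B" using bC by (force simp: centralizer_def)
    then show False using b cB by simp
  qed
  have AZ: "A = center G" using cB BG by (simp add: center_def)
  define z where "z = lg (center G)"
  have max': "lg U + lg (centralizer G U) < n + z"
    if "subgroup U G" "U \<noteq> center G" "U \<noteq> carrier G" for U
    using max[of U] that BG AZ by (simp add: z_def)
  have c: "z < lg (centralizer G {x}) \<and> lg (centralizer G {x}) + 1 < n
     \<and> z + 2 < n"
    if x: "x \<in> carrier G" "x \<notin> center G" for x
  proof -
    \<comment> \<open>\<open>?D\<close> is the center of \<open>?C\<close>, contains
      \<open>x\<close> and has centralizer \<open>?C\<close>. Both \<open>lg ?D\<close> and
      \<open>lg ?C\<close> exceed \<open>z\<close>, while their sum is below \<open>n + z\<close>;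
      the claimed bounds follow.\<close>
    let ?C = "centralizer G {x}" and ?D = "centralizer G (centralizer G {x})"
    have xC: "{x} \<subseteq> carrier G" using x by simp
    have sC: "subgroup ?C G" and sD: "subgroup ?D G"
      using x by (simp_all add: centralizer_subgroup centralizer_subset)
    have xD: "x \<in> ?D" using subset_centralizer_centralizer[OF xC] by simp
    have DC: "?D \<subseteq> ?C" using x by (intro centralizer_antimono) (simp add: mem_centralizer_self)
    have cD: "centralizer G ?D = ?C"
      by (intro equalityI centralizer_antimono subset_centralizer_centralizer xC centralizer_subset)
    have zC: "z < lg ?C" "lg ?C < n" using lg_center_less_centralizer[OF x] by (simp_all add: z_def)
    have zD: "z < lg ?D" unfolding z_def
      by (rule lg_less_mem[OF center_subgroup sD _ xD x(2)])
        (simp add: center_subset_centralizer centralizer_subset)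
    have "?D \<noteq> carrier G" using lg_mono[OF sD sC DC] zC by auto
    then have "lg ?D + lg ?C < n + z"
      using max'[OF sD] xD x cD by auto
    then show ?thesis using zC zD lg_mono[OF sD sC DC] by linarith
  qed
  have "center G \<noteq> carrier G" using AB BG AZ by auto
  then obtain x where x: "x \<in> second_center G" "x \<notin> center G"
    by (rule second_center_gt_center)
  have xC: "x \<in> carrier G" using x by (simp add: second_center_def)
  have "comm G x ` carrier G \<subseteq> center G"
    using x by (intro comm_image_subgroup(2)) (simp add: second_center_eq)
  then have "card (comm G x ` carrier G) \<le> card (center G)"
    using finite_subgroup[OF center_subgroup] by (rule card_mono[rotated])
  then have "n - lg (centralizer G {x}) \<le> z"
    using p_gt_1 by (simp add: card_comm_image_carrier[OF xC] card_eq_lg[OF center_subgroup] z_def)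
  moreover have "lg (centralizer G {x}) + 1 < n" "z + 2 < n"
    using c[OF xC x(2)] by simp_all
  \<comment> \<open>The index of \<open>C(x)\<close> is at least \<open>p^2\<close> and at most
    \<open>p^z\<close>, so \<open>2 \<le> z\<close>; with \<open>z + 2 < n \<le> 5\<close> only one
    pair remains.\<close>
  ultimately have nz: "n = 5" "z = 2" using n by linarith+
  have "lg (centralizer G {y}) \<le> 3" if "y \<in> carrier G - center G" for y
    using c[of y] that nz(1) by auto
  then show ?thesis using nz unfolding small_centralizers_def z_def by blast
qed

lemma subgroup_chain_CD_iff:
  assumes "n \<le> 5"
  shows "subgroup_chain G 1 (CD_lattice G) \<longleftrightarrow> small_centralizers"
proof
  assume "subgroup_chain G 1 (CD_lattice G)"
  then obtain S where S: "S 0 \<subset> S (Suc 0)" "CD_lattice G = S ` {..1}"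
    by (auto simp: subgroup_chain_def)
  have "S ` {..1} = {S 0, S (Suc 0)}"
    by (simp add: atMost_Suc insert_commute)
  then show small_centralizers
    using chain_imp_small_centralizers[OF assms _ S(1)] S(2) by metis
next
  assume sc: small_centralizers
  have neq: "center G \<noteq> carrier G"
  proof
    assume "center G = carrier G"
    then have "lg (center G) = n" by (rule ssubst) (rule lg_carrier)
    then show False using sc by (auto simp: small_centralizers_def)
  qed
  let ?S = "\<lambda>i::nat. if i = 0 then center G else carrier G"
  have S1: "\<forall>i\<le>1. subgroup (?S i) G"
    by (simp add: center_subgroup subgroup_self)
  have S2: "\<forall>i<1. ?S i \<subset> ?S (Suc i)"
    using neq center_subset by auto
  have S3: "?S ` {..1} = {center G, carrier G}"
    by (simp add: atMost_Suc insert_commute)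
  show "subgroup_chain G 1 (CD_lattice G)"
    unfolding subgroup_chain_def small_centralizers_imp_CD_lattice[OF sc]
    by (rule exI[of _ ?S]) (intro conjI S1 S2 S3[symmetric])
qed

section \<open>Nonabelian groups of order \<open>p^3\<close>, and exponents\<close>

lemma derived_subset_center:
  assumes "second_center G = carrier G"
  shows "derived G (carrier G) \<subseteq> center G"
  unfolding derived_def
proof (rule generate_subgroup_incl[OF _ center_subgroup])
  show "derived_set G (carrier G) \<subseteq> center G"
    using assms by (auto simp: second_center_eq centralizer_mod_def set_eq_iff comm_def)
qed

text \<open>The chain \<open>1 < Z < C(x) < G\<close> fills all exponents from 0 to 3. For the
  second center, an element \<open>x\<close> outside it would commute modulo the center with it and
  with \<open>x\<close>, hence with everything.\<close>

lemma order_p_cubed_centralizers: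
  assumes n: "n = 3" and nonab: "center G \<noteq> carrier G"
  shows "lg (center G) = 1"
    and "x \<in> carrier G \<Longrightarrow> x \<notin> center G \<Longrightarrow> lg (centralizer G {x}) = 2"
    and "second_center G = carrier G"
proof -
  have z0: "0 < lg (center G)" using lg_center_pos n by simp
  obtain y where y: "y \<in> carrier G" "y \<notin> center G"
    using nonab center_subset by blast
  show z: "lg (center G) = 1"
    using lg_center_less_centralizer[OF y] z0 n by linarith
  show "lg (centralizer G {x}) = 2" if "x \<in> carrier G" "x \<notin> center G"
    using lg_center_less_centralizer[OF that] z n by linarith
  obtain v where v: "v \<in> second_center G" "v \<notin> center G"
    using second_center_gt_center[OF nonab] by blast
  have z2: "2 \<le> lg (second_center G)"
    using lg_less_mem[OF center_subgroup second_center_subgroup center_subset_second_center v] z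
    by simp
  have "x \<in> second_center G" if x: "x \<in> carrier G" for x
  proof (rule ccontr)
    assume nx: "x \<notin> second_center G"
    let ?T = "centralizer_mod G (center G) {x}"
    have T: "subgroup ?T G"
      using x by (simp add: centralizer_mod_subgroup center_subgroup)
    have "x \<in> ?T" using x subgroup.one_closed[OF center_subgroup] by (simp add: centralizer_mod_def)
    moreover have "second_center G \<subseteq> ?T"
      using x by (auto simp: second_center_eq centralizer_mod_def)
    ultimately have "lg (second_center G) < lg ?T"
      using lg_less_mem[OF second_center_subgroup T] nx by blast
    then have "?T = carrier G" using z2 n by (intro lg_eq_carrier T) simp
    then have "x \<in> centralizer_mod G (center G) {y}" if "y \<in> carrier G" for y
      using that centralizer_mod_sym[OF center_subgroup x] by blast
    then have "x \<in> second_center G"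
      using x by (auto simp: second_center_eq centralizer_mod_def)
    with nx show False ..
  qed
  then show "second_center G = carrier G"
    by (auto simp: second_center_def)
qed

text \<open>The derived subgroup is a nontrivial subgroup of the center, which has order
  \<open>p\<close>. The two inclusions for the Frattini subgroup are proved separately.\<close>

lemma order_p_cubed_extraspecial:
  assumes n: "n = 3" and nonab: "center G \<noteq> carrier G"
  shows "extraspecial p G"
proof -
  note [simp] = center_subgroup
  note z = order_p_cubed_centralizers(1)[OF n nonab]
  note c = order_p_cubed_centralizers(2)[OF n nonab]
  note Z2 = order_p_cubed_centralizers(3)[OF n nonab]
  have commZ: "comm G x y \<in> center G" if "x \<in> carrier G" "y \<in> carrier G" for x y
    using Z2 that by (auto simp: second_center_eq centralizer_mod_def set_eq_iff)
  have cardZ: "card (center G) = p" using z card_eq_lg[OF center_subgroup] by simp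
  have D: "subgroup (derived G (carrier G)) G" by (simp add: derived_is_subgroup)
  have DZ: "derived G (carrier G) \<subseteq> center G" by (rule derived_subset_center[OF Z2])
  obtain x where x: "x \<in> carrier G" "x \<notin> center G"
    using nonab center_subset by blast
  then obtain y where y: "y \<in> carrier G" "comm G x y \<noteq> \<one>"
    by (auto simp: center_iff_comm)
  have "comm G x y \<in> derived G (carrier G)"
    unfolding derived_def by (rule generate.incl) (use x y in \<open>auto simp: comm_def\<close>)
  then have "lg {\<one>} < lg (derived G (carrier G))"
    using lg_less_mem[OF triv_subgroup D] y subgroup.one_closed[OF D] by blast
  then have ZD: "derived G (carrier G) = center G"
    using z by (intro lg_eqD[OF D center_subgroup DZ]) simp
  \<comment> \<open>Centralizers of noncentral elements have index \<open>p\<close>. They are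
    therefore maximal, and whatever lies in all of them is central.\<close>
  have c_max: "maximal_subgroup (centralizer G {x}) G" if x: "x \<in> carrier G" "x \<notin> center G" for x
  proof -
    have C: "subgroup (centralizer G {x}) G" using x by (simp add: centralizer_subgroup)
    have "H = centralizer G {x} \<or> H = carrier G"
      if "subgroup H G" "centralizer G {x} \<subseteq> H" for H
      using lg_less[OF C that] lg_eq_carrier[OF that(1)] c[OF x] n by fastforce
    then show ?thesis
      using C x by (auto simp: maximal_subgroup_def centralizer_singleton_eq_carrier_iff)
  qed
  have "frattini G \<subseteq> center G"
  proof
    fix q assume q: "q \<in> frattini G"
    then have qC: "q \<in> carrier G" by (simp add: frattini_def)
    have "comm G q u = \<one>" if u: "u \<in> carrier G" for u
    proof (cases "u \<in> center G")
      case True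
      then show ?thesis using qC by (simp add: comm_center)
    next
      case False
      then have "q \<in> centralizer G {u}"
        using c_max[OF u] q by (auto simp: frattini_def)
      then have "inv (comm G u q) = \<one>"
        using u by (simp add: mem_centralizer_singleton_iff)
      then show ?thesis using u qC by (simp add: inv_comm)
    qed
    then show "q \<in> center G" using qC by (simp add: center_iff_comm)
  qed
  moreover have "center G \<subseteq> M" if M: "maximal_subgroup M G" for M
  proof -
    have MG: "subgroup M G" "M \<noteq> carrier G"
      and Mmax: "\<And>H. subgroup H G \<Longrightarrow> M \<subseteq> H \<Longrightarrow> H = M \<or> H = carrier G"
      using M unfolding maximal_subgroup_def by blast+
    have MC: "M \<subseteq> carrier G" using MG subgroup.subset by blast
    show ?thesis
    proof (cases "M \<subseteq> center G")
      case True
      then have "M = center G" using Mmax[OF center_subgroup] nonab by auto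
      then show ?thesis by simp
    next
      case False
      then obtain m where m: "m \<in> M" "m \<notin> center G" by blast
      have mC: "m \<in> carrier G" using m MC by blast
      have C: "subgroup (centralizer G {m}) G" "subgroup (centralizer G {m} \<inter> M) G"
        using mC MG by (simp_all add: centralizer_subgroup subgroups_Inter_pair)
      show ?thesis
      proof (cases "M \<subseteq> centralizer G {m}")
        case True
        then have "centralizer G {m} = M"
          using Mmax[OF C(1)] mC m centralizer_singleton_eq_carrier_iff by blast
        then show ?thesis using center_subset_centralizer[of "{m}"] mC by simp
      next
        \<comment> \<open>Here \<open>[m, M]\<close> has at least \<open>p\<close> elements, so it
          exhausts the center, and it lies in \<open>M\<close>.\<close>
        case False
        then have "lg (centralizer G {m} \<inter> M) < lg M"
          by (intro lg_less[OF C(2) MG(1)]) auto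
        then have "p ^ 1 \<le> card (comm G m ` M)"
          unfolding card_comm_image[OF MG(1) mC] using p_gt_1 by (intro power_increasing) auto
        then have "card (center G) \<le> card (comm G m ` M)"
          using cardZ by simp
        moreover have "comm G m ` M \<subseteq> center G" using commZ mC MC by blast
        ultimately have "comm G m ` M = center G"
          using finite_subgroup[OF center_subgroup] by (intro card_seteq) auto
        moreover have "comm G m ` M \<subseteq> M"
          using comm_mem_subgroup[OF MG(1) m(1)] by blast
        ultimately show ?thesis by simp
      qed
    qed
  qed
  then have "center G \<subseteq> frattini G"
    using center_subset by (auto simp: frattini_def)
  ultimately have "center G = frattini G" by simp
  moreover have "p_group p G"
    using prime_p order_eq is_group by (auto simp: p_group_def)
  ultimately show ?thesis using ZD cardZ by (simp add: extraspecial_def)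
qed

text \<open>A nontrivial element, which exists because \<open>0 < n\<close>, has order exactly
  \<open>p\<close> and excludes smaller candidates.\<close>

lemma group_exponent_eq_p:
  assumes "0 < n" and pow: "\<And>x. x \<in> carrier G \<Longrightarrow> x [^] p = \<one>"
  shows "group_exponent G = p"
  unfolding group_exponent_def
proof (rule Least_equality)
  show "0 < p \<and> (\<forall>x\<in>carrier G. x [^] p = \<one>)" using p_gt_1 pow by simp
  fix k :: nat assume k: "0 < k \<and> (\<forall>x\<in>carrier G. x [^] k = \<one>)"
  have "1 < card (carrier G)"
    using one_less_power[OF p_gt_1 assms(1)] order_eq by (simp add: order_def)
  then have "carrier G \<noteq> {\<one>}" by force
  then obtain x where x: "x \<in> carrier G" "x \<noteq> \<one>" by blast
  then have "ord x dvd p" "ord x \<noteq> 1" using pow pow_eq_id ord_eq_1 by auto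
  then have "ord x = p" using prime_p by (metis prime_nat_iff)
  then show "p \<le> k" using k x pow_eq_id by (metis dvd_imp_le)
qed

text \<open>Every element is its own inverse, so \<open>x y = (x y)^-1 = y x\<close>. Applied to the
  nonabelian quotient by the center, this rules out \<open>p = 2\<close>.\<close>

lemma exponent_two_center:
  assumes "\<And>x. x \<in> carrier G \<Longrightarrow> x [^] (2::nat) = \<one>"
  shows "center G = carrier G"
proof -
  have inv: "inv x = x" if "x \<in> carrier G" for x
    using assms[OF that] that by (intro inv_equality) (simp_all add: numeral_2_eq_2)
  have "comm G x y = \<one>" if "x \<in> carrier G" "y \<in> carrier G" for x y
    using that inv[of "x \<otimes> y"] by (simp add: comm_def inv m_assoc[symmetric])
      (metis inv inv_mult_group m_assoc m_closed r_inv)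
  then show ?thesis by (auto simp: center_iff_comm)
qed

section \<open>Consequences of small centralizers\<close>

context
  assumes small: small_centralizers
begin

lemma n_eq: "n = 5" and lg_center: "lg (center G) = 2"
  and lg_centralizer_le: "\<And>x. x \<in> carrier G \<Longrightarrow> x \<notin> center G \<Longrightarrow> lg (centralizer G {x}) \<le> 3"
  using small by (auto simp: small_centralizers_def)

lemma card_center: "card (center G) = p ^ 2"
  using card_eq_lg[OF center_subgroup] by (simp add: lg_center)

lemma lg_centralizer:
  "x \<in> carrier G \<Longrightarrow> x \<notin> center G \<Longrightarrow> lg (centralizer G {x}) = 3"
  using lg_center_less_centralizer[of x] lg_centralizer_le[of x] lg_center by simp

text \<open>For noncentral \<open>x\<close> the quotient \<open>C(x)/Z\<close> has order
  \<open>p^3 / p^2 = p\<close> and contains the coset of \<open>x\<close>.\<close>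

lemma pow_p_center:
  assumes x: "x \<in> carrier G"
  shows "x [^] p \<in> center G"
proof (cases "x \<in> center G")
  case True
  then have "x [^] k \<in> center G" for k :: nat
    using center_subgroup by (induction k) (simp_all add: subgroup.one_closed subgroup.m_closed)
  then show ?thesis .
next
  case False
  let ?C = "centralizer G {x}" and ?Q = "G Mod center G"
  interpret Q: group ?Q by (rule normal.factorgroup_is_group[OF center_normal])
  interpret h: group_hom G ?Q "\<lambda>a. center G #> a"
    using normal.r_coset_hom_Mod[OF center_normal] is_group Q.is_group
    by (simp add: group_hom_def group_hom_axioms_def)
  have C: "subgroup ?C G" using x by (simp add: centralizer_subgroup)
  let ?S = "(\<lambda>a. center G #> a) ` ?C"
  have S: "subgroup ?S ?Q" by (rule h.subgroup_img_is_subgroup[OF C])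
  have "p ^ 3 = card ?S * p ^ 2"
    using card_subgroup_eq_card_cosets[OF C center_subgroup center_subset_centralizer] x
    by (simp add: card_center card_eq_lg[OF C] lg_centralizer False)
  then have cS: "card ?S = p" using p_gt_1 by (simp add: power3_eq_cube power2_eq_square)
  interpret S: group "?Q\<lparr>carrier := ?S\<rparr>" by (rule Q.subgroup_imp_group[OF S])
  have "center G #> x \<in> ?S" using x by (auto simp: mem_centralizer_self)
  then have "(center G #> x) [^]\<^bsub>?Q\<lparr>carrier := ?S\<rparr>\<^esub> order (?Q\<lparr>carrier := ?S\<rparr>) = \<one>\<^bsub>?Q\<lparr>carrier := ?S\<rparr>\<^esub>"
    by (intro S.pow_order_eq_1) simp
  then have "(center G #> x) [^]\<^bsub>?Q\<^esub> p = center G"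
    using cS by (simp add: order_def Q.nat_pow_consistent[symmetric])
  then have "center G #> (x [^] p) = center G"
    using x by (simp add: h.hom_nat_pow)
  then show ?thesis
    using x by (metis center_subgroup nat_pow_closed rcos_self)
qed

text \<open>The index of \<open>C(x)\<close> is \<open>p^(5-3)\<close>, which is already the order
  of the center.\<close>

lemma comm_image_eq_center:
  assumes "x \<in> second_center G" "x \<notin> center G"
  shows "comm G x ` carrier G = center G"
proof -
  have x: "x \<in> carrier G" using assms by (simp add: second_center_def)
  have "card (comm G x ` carrier G) = card (center G)"
    using card_comm_image_carrier[OF x] lg_centralizer[OF x assms(2)] by (simp add: n_eq card_center)
  moreover have "comm G x ` carrier G \<subseteq> center G"
    using assms by (intro comm_image_subgroup(2)) (simp add: second_center_eq)
  ultimately show ?thesis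
    using finite_subgroup[OF center_subgroup] by (simp add: card_subset_eq)
qed

lemma commutator_second_center:
  "commutator_subgroup G (second_center G) (carrier G) = center G"
proof
  have sub: "h \<otimes> k \<otimes> inv h \<otimes> inv k \<in> center G" if "h \<in> second_center G" "k \<in> carrier G" for h k
    using comm_image_subgroup(2)[of h] that by (auto simp: second_center_eq comm_def)
  show "commutator_subgroup G (second_center G) (carrier G) \<subseteq> center G"
    unfolding commutator_subgroup_def
    by (rule generate_subgroup_incl[OF _ center_subgroup]) (use sub in auto)
  have "center G \<noteq> carrier G" using lg_center lg_carrier n_eq by auto
  then obtain v where v: "v \<in> second_center G" "v \<notin> center G"
    by (rule second_center_gt_center)
  show "center G \<subseteq> commutator_subgroup G (second_center G) (carrier G)"
    unfolding comm_image_eq_center[OF v, symmetric] commutator_subgroup_def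
    using v(1) by (auto simp: comm_def intro!: generate.incl)
qed

text \<open>Otherwise the commutator modulo a subgroup \<open>K\<close> of order \<open>p\<close> of the center is an alternating form
  on \<open>G / Z(G)\<close>. Every \<open>?M x\<close> is the orthogonal complement of \<open>x\<close>, a plane that turns out to be
  isotropic; any other plane meets it in a line, which then lies in the radical.\<close>

lemma second_center_proper: "second_center G \<noteq> carrier G"
proof
  assume Z2: "second_center G = carrier G"
  note Z = center_subgroup
  interpret Z: group "G\<lparr>carrier := center G\<rparr>" by (rule subgroup_imp_group[OF Z])
  \<comment> \<open>Sylow's theorem in the form for arbitrary powers of \<open>p\<close> dividing
    the order supplies a subgroup of order \<open>p\<close> in the center.\<close>
  have "\<exists>K. subgroup K (G\<lparr>carrier := center G\<rparr>) \<and> card K = p ^ 1"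
  proof (rule sylow_thm[OF prime_p Z.is_group])
    show "order (G\<lparr>carrier := center G\<rparr>) = p ^ 1 * p"
      by (simp add: order_def card_center power2_eq_square)
    show "finite (carrier (G\<lparr>carrier := center G\<rparr>))"
      using finite_subgroup[OF Z] by simp
  qed
  then obtain K where "subgroup K (G\<lparr>carrier := center G\<rparr>)" and cK: "card K = p" by auto
  then have K: "subgroup K G" and KZ: "K \<subseteq> center G"
    using incl_subgroup[OF Z] subgroup.subset by force+
  let ?M = "\<lambda>x. centralizer_mod G K {x}"
  have sM: "subgroup (?M x) G" if "x \<in> carrier G" for x
    using that by (intro centralizer_mod_subgroup K KZ) simp
  have ZM: "center G \<subseteq> ?M x" if "x \<in> carrier G" for x
    using that by (simp add: center_subset_centralizer_mod[OF K])
  have selfM: "x \<in> ?M x" if "x \<in> carrier G" for x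
    using that subgroup.one_closed[OF K] by (simp add: centralizer_mod_def)
  have lgM: "lg (?M x) = 4" if x: "x \<in> carrier G" "x \<notin> center G" for x
  proof -
    \<comment> \<open>\<open>comm G x\<close> maps \<open>G\<close> onto the center with kernel
      \<open>C(x)\<close>, so \<open>?M x\<close> is the preimage of \<open>K\<close> and has
      exponent \<open>3 + 1\<close>.\<close>
    have "comm G x ` ?M x = K"
      using comm_image_eq_center[of x] Z2 x KZ by (auto simp: centralizer_mod_def)
    moreover have "centralizer G {x} \<inter> ?M x = centralizer G {x}"
      using centralizer_subset_centralizer_mod[OF K x(1)] by blast
    ultimately have "p ^ 1 = p ^ (lg (?M x) - 3)"
      using card_comm_image[OF sM[OF x(1)] x(1)] cK lg_centralizer[OF x] by simp
    then have "1 = lg (?M x) - 3"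
      using p_gt_1 power_inject_exp by blast
    then show ?thesis by simp
  qed
  have "center G \<noteq> carrier G" using lg_center lg_carrier n_eq by auto
  then obtain x where x: "x \<in> carrier G" "x \<notin> center G" using center_subset by blast
  have MC: "?M x \<subseteq> carrier G" using subgroup.subset[OF sM[OF x(1)]] .
  have isotropic: "?M x \<subseteq> ?M g" if g: "g \<in> ?M x" for g
  proof (rule ccontr)
    assume ng: "\<not> ?M x \<subseteq> ?M g"
    have gC: "g \<in> carrier G" using g MC by blast
    \<comment> \<open>\<open>?D\<close> is the radical of the form on \<open>?M x\<close> and
      contains \<open>x\<close>. A \<open>g\<close> outside it would give
      \<open>2 < lg ?D < lg ?E < lg (?M x) = 4\<close>.\<close>
    let ?D = "centralizer_mod G K (?M x) \<inter> ?M x" and ?E = "?M g \<inter> ?M x"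
    have D: "subgroup ?D G" and E: "subgroup ?E G"
      using sM x gC by (simp_all add: subgroups_Inter_pair centralizer_mod_subgroup[OF K KZ MC])
    have "x \<in> ?D"
      using x selfM[OF x(1)] MC centralizer_mod_sym[OF K x(1)]
      by (fastforce simp: centralizer_mod_def)
    moreover have "center G \<subseteq> ?D"
      using ZM[OF x(1)] center_subset_centralizer_mod[OF K MC] by blast
    ultimately have "2 < lg ?D" using lg_less_mem[OF Z D] x lg_center by simp
    moreover have "lg ?D < lg ?E"
    proof (rule lg_less_mem[OF D E])
      show "?D \<subseteq> ?E" using g by (auto simp: centralizer_mod_def)
      show "g \<in> ?E" using g gC selfM by blast
      have "g \<notin> centralizer_mod G K (?M x)"
      proof
        assume "g \<in> centralizer_mod G K (?M x)"
        then have "g \<in> ?M h" if "h \<in> ?M x" for h using that by (auto simp: centralizer_mod_def)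
        then have "?M x \<subseteq> ?M g" using centralizer_mod_sym[OF K] MC by blast
        with ng show False ..
      qed
      then show "g \<notin> ?D" by blast
    qed
    moreover have "lg ?E < lg (?M x)"
      using ng by (intro lg_less[OF E sM[OF x(1)]]) auto
    ultimately show False using lgM[OF x] by simp
  qed
  have "?M x \<noteq> carrier G" using lgM[OF x] n_eq lg_carrier by auto
  then obtain z where z: "z \<in> carrier G" "z \<notin> ?M x" using MC by blast
  have zZ: "z \<notin> center G" using ZM[OF x(1)] z by blast
  \<comment> \<open>\<open>w\<close> spans the line where the planes of \<open>x\<close> and
    \<open>z\<close> meet. If no noncentral element of \<open>?M x\<close> commutes with
    \<open>z\<close>, then \<open>[z, ?M x]\<close> has \<open>p^(4-2)\<close> elements, hence is
    the whole center, and any nontrivial \<open>k\<close> in \<open>K\<close> has a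
    preimage.\<close>
  obtain w where w: "w \<in> ?M x" "w \<in> ?M z" "w \<notin> center G"
  proof (cases "centralizer G {z} \<inter> ?M x \<subseteq> center G")
    case True
    then have "centralizer G {z} \<inter> ?M x = center G"
      using ZM[OF x(1)] center_subset_centralizer[of "{z}"] z by blast
    then have "card (comm G z ` ?M x) = card (center G)"
      using card_comm_image[OF sM[OF x(1)] z(1)] by (simp add: lgM[OF x] lg_center card_center)
    moreover have "comm G z ` ?M x \<subseteq> center G"
      using comm_image_eq_center[of z] Z2 z zZ MC by auto
    ultimately have im: "comm G z ` ?M x = center G"
      using finite_subgroup[OF Z] by (intro card_subset_eq) auto
    have "K \<noteq> {\<one>}" using cK p_gt_1 by auto
    then obtain k where k: "k \<in> K" "k \<noteq> \<one>" using subgroup.one_closed[OF K] by blast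
    then obtain w where w: "w \<in> ?M x" "comm G z w = k" using im KZ by (metis imageE subsetD)
    show thesis
    proof (rule that[of w])
      show "w \<in> ?M z" using w k MC by (auto simp: centralizer_mod_def)
      show "w \<notin> center G" using w k z comm_center by auto
    qed (rule w)
  next
    case False
    then obtain w where "w \<in> centralizer G {z}" "w \<in> ?M x" "w \<notin> center G" by blast
    then show thesis
      using that centralizer_subset_centralizer_mod[OF K z(1)] by blast
  qed
  have wC: "w \<in> carrier G" using w MC by blast
  \<comment> \<open>By isotropy \<open>?M w\<close> contains \<open>?M x\<close>, and by the choice
    of \<open>w\<close> also \<open>z\<close>; both have exponent 4, a contradiction.\<close>
  have "lg (?M x) < lg (?M w)"
    using isotropic[OF w(1)] centralizer_mod_sym[OF K z(1) w(2)] z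
    by (intro lg_less_mem[OF sM[OF x(1)] sM[OF wC]]) auto
  then show False using lgM[OF x] lgM[OF wC w(3)] by simp
qed

lemma small_centralizers_imp:
  "p \<noteq> 2 \<and> order G = p ^ 5 \<and> card (center G) = p ^ 2 \<and>
   extraspecial p (G Mod center G) \<and> group_exponent (G Mod center G) = p \<and>
   commutator_subgroup G (second_center G) (carrier G) = center G"
proof -
  interpret Q: prime_power_group "G Mod center G" p 3
    using quotient_by_center by (simp add: lg_center n_eq)
  interpret h: group_hom G "G Mod center G" "\<lambda>a. center G #> a"
    using normal.r_coset_hom_Mod[OF center_normal] is_group Q.is_group
    by (simp add: group_hom_def group_hom_axioms_def)
  have nonab: "center (G Mod center G) \<noteq> carrier (G Mod center G)"
    using second_center_proper by (auto simp: second_center_def carrier_FactGroup)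
  have pow: "a [^]\<^bsub>G Mod center G\<^esub> p = \<one>\<^bsub>G Mod center G\<^esub>"
    if "a \<in> carrier (G Mod center G)" for a
  proof -
    obtain x where x: "x \<in> carrier G" "a = center G #> x"
      using \<open>a \<in> _\<close> by (auto simp: carrier_FactGroup)
    have "a [^]\<^bsub>G Mod center G\<^esub> p = center G #> (x [^] p)"
      using x by (simp add: h.hom_nat_pow)
    also have "\<dots> = center G"
      using pow_p_center[OF x(1)] by (simp add: coset_join2 center_subgroup x)
    finally show ?thesis by simp
  qed
  have "p \<noteq> 2" using Q.exponent_two_center pow nonab by blast
  then show ?thesis
    using order_eq n_eq card_center Q.order_p_cubed_extraspecial nonab
      Q.group_exponent_eq_p pow commutator_second_center by simp
qed

end

section \<open>From the structure of the group back to small centralizers\<close>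

lemma imp_small_centralizers:
  assumes n: "order G = p ^ 5" and z: "card (center G) = p ^ 2"
    and es: "card (center (G Mod center G)) = p"
    and com: "commutator_subgroup G (second_center G) (carrier G) = center G"
  shows small_centralizers
proof -
  interpret Q: prime_power_group "G Mod center G" p "n - lg (center G)"
    by (rule quotient_by_center)
  note Z = center_subgroup and S = second_center_subgroup
  have n5: "n = 5" using n order_eq p_gt_1 power_inject_exp by metis
  have z2: "lg (center G) = 2" by (rule lg_eqI[OF z])
  have s3: "lg (second_center G) = 3"
    using Q.lg_eqI[of _ 1] es by (simp add: lg_second_center z2)
  have *: "lg (centralizer G {u}) \<le> 3" if u: "u \<in> second_center G" "u \<notin> center G" for u
  proof (rule ccontr)
    assume gt: "\<not> lg (centralizer G {u}) \<le> 3"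
    have uC: "u \<in> carrier G" using u by (simp add: second_center_def)
    let ?K = "comm G u ` carrier G"
    have K: "subgroup ?K G" "?K \<subseteq> center G"
      using comm_image_subgroup u(1) by (auto simp: second_center_eq)
    \<comment> \<open>\<open>?N\<close> is the preimage of the center of \<open>G/?K\<close>. It
      contains \<open>u\<close> and lies between the center and the second center, whose indices
      differ by \<open>p\<close>, so it is the second center. Then \<open>[Z_2, P]\<close> lies in
      \<open>?K\<close>, which has order at most \<open>p\<close>.\<close>
    let ?N = "centralizer_mod G ?K (carrier G)"
    have N: "subgroup ?N G" by (rule centralizer_mod_subgroup[OF K]) simp
    have sub: "?N \<subseteq> second_center G" using K(2) by (auto simp: second_center_eq centralizer_mod_def)
    have "comm G g u \<in> ?K" if "g \<in> carrier G" for g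
      using subgroup.m_inv_closed[OF K(1), of "comm G u g"] inv_comm[OF uC that] that by simp
    then have "u \<in> ?N" using uC by (simp add: centralizer_mod_def)
    then have "lg (center G) < lg ?N"
      using u by (intro lg_less_mem[OF Z N]) (auto simp: center_subset_centralizer_mod K)
    then have "?N = second_center G"
      using s3 z2 by (intro lg_eqD[OF N S sub]) simp
    then have sub': "comm G h k \<in> ?K" if "h \<in> second_center G" "k \<in> carrier G" for h k
    proof -
      have "h \<in> ?N" using \<open>?N = _\<close> that by simp
      then have "comm G k h \<in> ?K" "h \<in> carrier G" using that by (auto simp: centralizer_mod_def)
      then show ?thesis
        using subgroup.m_inv_closed[OF K(1), of "comm G k h"] inv_comm[of k h] that by simp
    qed
    have "commutator_subgroup G (second_center G) (carrier G) \<subseteq> ?K"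
      unfolding commutator_subgroup_def
      by (rule generate_subgroup_incl[OF _ K(1)]) (use sub' in \<open>auto simp: comm_def\<close>)
    then have "lg (center G) \<le> lg ?K"
      using com by (intro lg_mono[OF Z K(1)]) simp
    moreover have "lg ?K = n - lg (centralizer G {u})"
      by (rule lg_eqI[OF card_comm_image_carrier[OF uC]])
    ultimately show False using z2 n5 gt by simp
  qed
  have "lg (centralizer G {u}) \<le> 3" if u: "u \<in> carrier G" "u \<notin> center G" for u
  proof (rule ccontr)
    assume "\<not> lg (centralizer G {u}) \<le> 3"
    then have gt: "4 \<le> lg (centralizer G {u})" by simp
    then have nu: "u \<notin> second_center G" using *[of u] u by force
    have C: "subgroup (centralizer G {u}) G" using u by (simp add: centralizer_subgroup)
    let ?N = "centralizer_mod G (center G) {u}"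
    have N: "subgroup ?N G" using u by (simp add: centralizer_mod_subgroup Z)
    have "?N \<noteq> carrier G"
    proof
      assume "?N = carrier G"
      then have "u \<in> centralizer_mod G (center G) {g}" if "g \<in> carrier G" for g
        using that centralizer_mod_sym[OF Z u(1)] by blast
      then show False using nu u by (auto simp: second_center_eq centralizer_mod_def)
    qed
    then have "lg ?N < 5" using lg_proper[OF N] n5 by simp
    \<comment> \<open>Elements commuting with \<open>u\<close> modulo the center form a proper
      subgroup containing \<open>C(u)\<close>, which already has index \<open>p\<close>. So
      \<open>u\<close> commutes with the whole second center.\<close>
    then have "centralizer G {u} = ?N"
      using gt by (intro lg_eqD[OF C N centralizer_subset_centralizer_mod[OF Z u(1)]]) simp
    then have SC: "second_center G \<subseteq> centralizer G {u}"
      using u by (auto simp: second_center_eq centralizer_mod_def)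
    have "center G \<noteq> carrier G" using u by blast
    then obtain v where v: "v \<in> second_center G" "v \<notin> center G"
      by (rule second_center_gt_center)
    have vC: "v \<in> carrier G" using v by (simp add: second_center_def)
    have Cv: "subgroup (centralizer G {v}) G" using vC by (simp add: centralizer_subgroup)
    have I: "subgroup (centralizer G {v} \<inter> second_center G) G"
      by (intro subgroups_Inter_pair Cv S)
    \<comment> \<open>The second center has order \<open>p\<close> modulo the center, so
      \<open>v\<close> centralizes all of it. As \<open>u\<close> also lies in \<open>C(v)\<close>,
      that centralizer is too large for the case settled first.\<close>
    have "lg (center G) < lg (centralizer G {v} \<inter> second_center G)"
      using v vC center_subset_centralizer[of "{v}"] center_subset_second_center
      by (intro lg_less_mem[OF Z I, of v]) (auto simp: mem_centralizer_self)
    then have "centralizer G {v} \<inter> second_center G = second_center G"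
      using z2 s3 by (intro lg_eqD[OF I S]) auto
    moreover have "u \<in> centralizer G {v}"
      using v SC u by (auto simp: centralizer_def)
    ultimately have "lg (second_center G) < lg (centralizer G {v})"
      using nu by (intro lg_less_mem[OF S Cv, of u]) auto
    then show False using s3 *[OF v] by simp
  qed
  then show ?thesis using n5 z2 unfolding small_centralizers_def by blast
qed

end

theorem proposition2p1:
  fixes p :: nat and P :: "('a, 'b) monoid_scheme"
  assumes "Factorial_Ring.prime p"
    and "p_group p P"
    and "order P \<le> p ^ 5"
  shows "subgroup_chain P 1 (CD_lattice P) \<longleftrightarrow>
    p \<noteq> 2 \<and>
    order P = p ^ 5 \<and>
    card (center P) = p ^ 2 \<and>
    extraspecial p (P Mod center P) \<and>
    group_exponent (P Mod center P) = p \<and>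
    commutator_subgroup P (second_center P) (carrier P) = center P"
proof -
  obtain n where "group P" "order P = p ^ n"
    using assms(2) by (auto simp: p_group_def)
  then interpret prime_power_group P p n
    using assms(1) by (simp add: prime_power_group_def prime_power_group_axioms_def)
  have "n \<le> 5" using assms(3) order_eq p_gt_1 by simp
  then show ?thesis
    using subgroup_chain_CD_iff small_centralizers_imp imp_small_centralizers
    by (auto simp: extraspecial_def)
qed

end
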